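(* For every positive integer $n$, let $D_n$ be the digraph with vertex set $K(D_n)\cup I(D_n)$, where \[ K(D_n) = \{k_0,\ldots,k_{2n}\},\qquad I(D_n)=\{s_{ij}\colon 0\leq i\leq 2n,\ 1\leq j\leq n\}, \] (all these vertices being distinct) and with arc set \[ A(D_n)=\{(k_i,k_{i+j})\colon 0\leq i\leq 2n,\ 1\leq j\leq n\}\cup\{(s_{ij},k_i)\colon 0\leq i\leq 2n,\ 1\leq j\leq n\}, \] where the sum $i+j$ in the index of $k_{i+j}$ is taken modulo $2n+1$. Denote by $Q_n$ a smallest quasi-kernel of $D_n$. Then \[ \lim_{n\to+\infty}\frac{|Q_n|}{|V(D_n)|}=\frac{1}{2}. \]
   Context: A quasi-kernel of a digraph $D$ is an independent set $Q\subseteq V(D)$ (no arc between any two vertices of $Q$) such that from every vertex of $D$ there is a directed path of length at most two to some vertex of $Q$ (length zero for vertices of $Q$). Every finite digraph has a quasi-kernel, so a smallest one (a quasi-kernel of minimum cardinality) exists. *)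

theory Defs
  imports Complex_Main "Graph_Theory.Pair_Digraph"
begin

text \<open>Only arcs between distinct vertices are forbidden, so a loop does not prevent its vertex
  from lying in an independent set. The digraphs considered below are loopless.\<close>

definition independent_set :: "('a, 'b) pre_digraph \<Rightarrow> 'a set \<Rightarrow> bool" where
  "independent_set G Q \<longleftrightarrow>
     Q \<subseteq> verts G \<and> (\<forall>u\<in>Q. \<forall>v\<in>Q. u \<noteq> v \<longrightarrow> \<not> u \<rightarrow>\<^bsub>G\<^esub> v)"

definition quasi_kernel :: "('a, 'b) pre_digraph \<Rightarrow> 'a set \<Rightarrow> bool" where
  "quasi_kernel G Q \<longleftrightarrow>
     independent_set G Q \<and>
     (\<forall>u\<in>verts G. \<exists>v\<in>Q. \<exists>p. pre_digraph.apath G u p v \<and> length p \<le> 2)"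

text \<open>Meaningful for finite digraphs only, as \<^const>\<open>card\<close> is 0 on infinite sets.\<close>

definition smallest_quasi_kernel :: "('a, 'b) pre_digraph \<Rightarrow> 'a set \<Rightarrow> bool" where
  "smallest_quasi_kernel G Q \<longleftrightarrow> is_arg_min card (quasi_kernel G) Q"

datatype vertex = K nat | S nat nat

definition D :: "nat \<Rightarrow> vertex pair_pre_digraph" where
  "D n = \<lparr>
     pverts = {K i |i. i \<le> 2 * n} \<union> {S i j |i j. i \<le> 2 * n \<and> 1 \<le> j \<and> j \<le> n},
     parcs = {(K i, K ((i + j) mod (2 * n + 1))) |i j. i \<le> 2 * n \<and> 1 \<le> j \<and> j \<le> n}
           \<union> {(S i j, K i) |i j. i \<le> 2 * n \<and> 1 \<le> j \<and> j \<le> n}\<rparr>"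

lemma finite_pverts_D: "finite (pverts (D n))"
proof -
  have "pverts (D n) \<subseteq> K ` {..2 * n} \<union> case_prod S ` ({..2 * n} \<times> {..n})"
    by (auto simp: D_def)
  then show ?thesis by (rule finite_subset) auto
qed

lemma pair_digraph_D: "pair_digraph (D n)"
proof
  show wf1: "fst e \<in> pverts (D n)" if "e \<in> parcs (D n)" for e
    using that by (auto simp: D_def)
  show wf2: "snd e \<in> pverts (D n)" if "e \<in> parcs (D n)" for e
    using that by (auto simp: D_def less_Suc_eq_le[symmetric])
  show "finite (pverts (D n))" by (rule finite_pverts_D)
  have "parcs (D n) \<subseteq> pverts (D n) \<times> pverts (D n)"
    using wf1 wf2 by (auto simp: mem_Times_iff)
  then show "finite (parcs (D n))"
    by (rule finite_subset) (simp add: finite_pverts_D)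
  have "(i + j) mod (2 * n + 1) \<noteq> i" if "i \<le> 2 * n" "1 \<le> j" "j \<le> n" for i j
  proof (cases "i + j < 2 * n + 1")
    case False
    then have "(i + j) mod (2 * n + 1) = i + j - (2 * n + 1)"
      using that by (simp add: le_mod_geq)
    then show ?thesis using that False by linarith
  qed (use that in auto)
  then show "fst e \<noteq> snd e" if "e \<in> parcs (D n)" for e
    using that by (fastforce simp: D_def)
qed

lemma quasi_kernel_D:
  "quasi_kernel (with_proj (D n)) ({K 0} \<union> {S i j |i j. 1 \<le> i \<and> i \<le> n \<and> 1 \<le> j \<and> j \<le> n})"
    (is "quasi_kernel ?G ?Q")
proof -
  have "independent_set ?G ?Q"
    by (auto simp: independent_set_def D_def)
  moreover have "\<exists>v\<in>?Q. \<exists>p. pre_digraph.apath ?G u p v \<and> length p \<le> 2" if u: "u \<in> verts ?G" for u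
  proof -
    have nil: "\<exists>v\<in>?Q. \<exists>p. pre_digraph.apath ?G u p v \<and> length p \<le> 2" if "u \<in> ?Q"
      using that u by (intro bexI[of _ u] exI[of _ "[]"])
        (auto simp: pre_digraph.apath_def pre_digraph.awalk_def pre_digraph.awalk_verts.simps
          pre_digraph.cas.simps)
    have one: "\<exists>v\<in>?Q. \<exists>p. pre_digraph.apath ?G u p v \<and> length p \<le> 2"
      if "(u, K 0) \<in> parcs (D n)" "u \<noteq> K 0"
      using that u by (intro bexI[of _ "K 0"] exI[of _ "[(u, K 0)]"])
        (auto simp: pre_digraph.apath_def pre_digraph.awalk_def pre_digraph.awalk_verts.simps
          pre_digraph.cas.simps)
    have two: "\<exists>v\<in>?Q. \<exists>p. pre_digraph.apath ?G u p v \<and> length p \<le> 2"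
      if "(u, w) \<in> parcs (D n)" "(w, K 0) \<in> parcs (D n)" "u \<noteq> K 0" "u \<noteq> w" "w \<noteq> K 0" for w
      using that u by (intro bexI[of _ "K 0"] exI[of _ "[(u, w), (w, K 0)]"])
        (auto simp: pre_digraph.apath_def pre_digraph.awalk_def pre_digraph.awalk_verts.simps
          pre_digraph.cas.simps)
    have arc0: "(K i, K 0) \<in> parcs (D n)" if "n < i" "i \<le> 2 * n" for i
      using that by (auto simp: D_def intro!: exI[of _ i] exI[of _ "2 * n + 1 - i"])
    have arcS: "(S i j, K i) \<in> parcs (D n)" if "i \<le> 2 * n" "1 \<le> j" "j \<le> n" for i j
      using that by (auto simp: D_def)
    have arcn: "(K i, K (i + n)) \<in> parcs (D n)" if "1 \<le> i" "i \<le> n" for i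
      using that by (auto simp: D_def intro!: exI[of _ i] exI[of _ n])
    show ?thesis
    proof (cases u)
      case (K i)
      then have "i \<le> 2 * n" using u by (auto simp: D_def)
      then consider "i = 0" | "1 \<le> i" "i \<le> n" | "n < i" "i \<le> 2 * n" by linarith
      then show ?thesis
      proof cases
        case 1 then show ?thesis using nil K by auto
      next
        case 2 then show ?thesis using two[of "K (i + n)"] arcn[of i] arc0[of "i + n"] K by auto
      next
        case 3 then show ?thesis using one arc0[of i] K by auto
      qed
    next
      case (S i j)
      then have ij: "i \<le> 2 * n" "1 \<le> j" "j \<le> n" using u by (auto simp: D_def)
      then consider "i = 0" | "1 \<le> i" "i \<le> n" | "n < i" "i \<le> 2 * n" by linarith
      then show ?thesis
      proof cases
        case 1 then show ?thesis using one arcS[OF ij] S by auto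
      next
        case 2 then show ?thesis using nil ij S by auto
      next
        case 3 then show ?thesis using two[of "K i"] arcS[OF ij] arc0[of i] S by auto
      qed
    qed
  qed
  ultimately show ?thesis by (simp add: quasi_kernel_def)
qed

lemma ex_smallest_quasi_kernel_D: "\<exists>Q. smallest_quasi_kernel (with_proj (D n)) Q"
  using ex_has_least_nat[of "quasi_kernel (with_proj (D n))", OF quasi_kernel_D, of card]
  by (auto simp: smallest_quasi_kernel_def is_arg_min_linorder)

end

theory Submission
  imports Defs "HOL-Real_Asymp.Real_Asymp"
begin

text \<open>The vertices \<open>k\<^sub>i\<close> induce a tournament, so a quasi-kernel \<open>Q\<close> contains at most one of them.
  A vertex \<open>s\<^sub>i\<^sub>j\<close> outside \<open>Q\<close> must reach \<open>Q\<close> through \<open>k\<^sub>i\<close>, within one further arc. Hence if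
  \<open>k\<^sub>i \<in> Q\<close>, then \<open>Q\<close> contains all \<open>n\<^sup>2\<close> vertices \<open>s\<^sub>l\<^sub>j\<close> attached to the \<open>n\<close> out-neighbours \<open>k\<^sub>l\<close> of
  \<open>k\<^sub>i\<close>; and if \<open>Q\<close> contains no \<open>k\<^sub>i\<close>, then it contains every \<open>s\<^sub>i\<^sub>j\<close>. So a smallest quasi-kernel has
  exactly \<open>n\<^sup>2 + 1\<close> of the \<open>(2n + 1)(n + 1)\<close> vertices.\<close>

text \<open>For \<open>m\<close> = 2n + 1 this rules out loops (\<open>d\<close> at most n) and
  2-cycles (\<open>d\<close> a sum of two steps, at most 2n) among the \<open>K\<close>
  vertices.\<close>

lemma mod_add_neq_self:
  fixes i d m :: nat
  assumes "0 < d" "d < m"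
  shows "(i + d) mod m \<noteq> i"
proof
  assume eq: "(i + d) mod m = i"
  then have "i < m" using assms by (metis mod_less_divisor less_trans)
  then show False using eq assms by (auto simp: mod_if split: if_splits)
qed

lemma card_pverts_D: "card (pverts (D n)) = (2 * n + 1) * (n + 1)"
proof -
  have "pverts (D n) = K ` {..2 * n} \<union> case_prod S ` ({..2 * n} \<times> {1..n})"
    by (force simp: D_def)
  moreover have "card (K ` {..2 * n}) = 2 * n + 1"
    by (simp add: card_image inj_on_def)
  moreover have "card (case_prod S ` ({..2 * n} \<times> {1..n})) = (2 * n + 1) * n"
    by (subst card_image) (auto simp: inj_on_def)
  moreover have "K ` {..2 * n} \<inter> case_prod S ` ({..2 * n} \<times> {1..n}) = {}"
    by auto
  ultimately show ?thesis by (simp add: card_Un_disjoint)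
qed

lemma quasi_kernel_subset: "quasi_kernel G Q \<Longrightarrow> Q \<subseteq> verts G"
  by (simp add: quasi_kernel_def independent_set_def)

lemma parcs_D_K:
  "i \<le> 2 * n \<Longrightarrow> 1 \<le> j \<Longrightarrow> j \<le> n \<Longrightarrow> (K i, K ((i + j) mod (2 * n + 1))) \<in> parcs (D n)"
  by (auto simp: D_def)

lemma quasi_kernel_D_K_unique:
  assumes qk: "quasi_kernel (with_proj (D n)) Q" and "K a \<in> Q" "K b \<in> Q"
  shows "a = b"
proof -
  have no_less: False if "K a \<in> Q" "K b \<in> Q" "a < b" for a b
  proof -
    have b: "b \<le> 2 * n"
      using quasi_kernel_subset[OF qk] \<open>K b \<in> Q\<close> by (auto simp: D_def)
    have "(K a, K b) \<in> parcs (D n) \<or> (K b, K a) \<in> parcs (D n)"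
    proof (cases "b - a \<le> n")
      case True
      then show ?thesis using parcs_D_K[of a n "b - a"] b \<open>a < b\<close> by simp
    next
      case False
      \<comment> \<open>The two cyclic distances between \<open>a\<close> and \<open>b\<close> sum
        to 2n + 1, so one is at most n. Here it is \<open>?d\<close>, giving an arc from
        \<open>K b\<close> past the wrap-around to \<open>K a\<close>.\<close>
      let ?d = "2 * n + 1 - (b - a)"
      have "b + ?d = a + (2 * n + 1)" using b \<open>a < b\<close> by linarith
      then have "(b + ?d) mod (2 * n + 1) = a"
        using b \<open>a < b\<close> by (simp only: mod_add_self2 mod_less)
      moreover have "1 \<le> ?d" "?d \<le> n" using b False by linarith+
      ultimately show ?thesis using parcs_D_K[of b n ?d] b by simp
    qed
    then show False
      using qk that by (auto simp: quasi_kernel_def independent_set_def)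
  qed
  show ?thesis using no_less assms by (metis linorder_neqE_nat)
qed

text \<open>The cases are the path lengths 0, 1 and 2: the only arc out of \<open>S l j\<close>
  leads to \<open>K l\<close>, whose out-arcs all end in \<open>K\<close> vertices.\<close>

lemma quasi_kernel_D_S_cases:
  assumes "quasi_kernel (with_proj (D n)) Q" "l \<le> 2 * n" "1 \<le> j" "j \<le> n"
  obtains "S l j \<in> Q" | "K l \<in> Q"
    | d where "1 \<le> d" "d \<le> n" "K ((l + d) mod (2 * n + 1)) \<in> Q"
proof -
  have "S l j \<in> verts (with_proj (D n))" using assms by (auto simp: D_def)
  then obtain v p where v: "v \<in> Q" and p: "pre_digraph.apath (with_proj (D n)) (S l j) p v"
    and len: "length p \<le> 2"
    using assms(1) unfolding quasi_kernel_def by blast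
  have walk: "pre_digraph.cas (with_proj (D n)) (S l j) p v" "set p \<subseteq> parcs (D n)"
    using p by (auto simp: pre_digraph.apath_def pre_digraph.awalk_def)
  consider "p = []" | e where "p = [e]" | e f where "p = [e, f]"
    using len by (cases p; cases "tl p"; auto)
  then show ?thesis
  proof cases
    case 1
    then show ?thesis using walk v that(1) by (simp add: pre_digraph.cas.simps)
  next
    case (2 e)
    then have "v = K l" using walk by (auto simp: pre_digraph.cas.simps D_def)
    then show ?thesis using v that(2) by simp
  next
    case (3 e f)
    then have "\<exists>d. 1 \<le> d \<and> d \<le> n \<and> v = K ((l + d) mod (2 * n + 1))"
      using walk by (auto simp: pre_digraph.cas.simps D_def)
    then show ?thesis using v that(3) by auto
  qed
qed

lemma card_quasi_kernel_D_ge: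
  assumes qk: "quasi_kernel (with_proj (D n)) Q" and n: "1 \<le> n"
  shows "n\<^sup>2 + 1 \<le> card Q"
proof -
  have fin: "finite Q"
    using quasi_kernel_subset[OF qk] finite_pverts_D[of n] by (auto intro: finite_subset)
  have card_S: "card (case_prod S ` (L \<times> {1..n})) = card L * n" for L
    by (subst card_image) (auto simp: inj_on_def card_cartesian_product)
  show ?thesis
  proof (cases "\<exists>i. K i \<in> Q")
    case True
    then obtain i where i: "K i \<in> Q" by blast
    \<comment> \<open>\<open>L\<close> indexes the out-neighbours of \<open>K i\<close>.\<close>
    define L where "L = (\<lambda>d. (i + d) mod (2 * n + 1)) ` {1..n}"
    have "inj_on (\<lambda>d. (i + d) mod (2 * n + 1)) {1..n}"
    proof (rule linorder_inj_onI)
      fix d e :: nat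
      assume "d < e" "d \<in> {1..n}" "e \<in> {1..n}"
      \<comment> \<open>The difference \<open>e - d\<close> lies strictly between 0 and n.\<close>
      then have "\<not> 2 * n + 1 dvd (i + e) - (i + d)"
        by (auto dest!: dvd_imp_le)
      then show "(i + d) mod (2 * n + 1) \<noteq> (i + e) mod (2 * n + 1)"
        using mod_eq_dvd_iff_nat[of "i + d" "i + e" "2 * n + 1"] \<open>d < e\<close> by auto
    qed auto
    then have "card L = n" by (simp add: L_def card_image)
    have S_in: "S l j \<in> Q" if "l \<in> L" "1 \<le> j" "j \<le> n" for l j
    proof -
      obtain d where d: "1 \<le> d" "d \<le> n" and l: "l = (i + d) mod (2 * n + 1)"
        using \<open>l \<in> L\<close> by (auto simp: L_def)
      have "l \<le> 2 * n" using l by (simp add: less_Suc_eq_le[symmetric])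
      from quasi_kernel_D_S_cases[OF qk this \<open>1 \<le> j\<close> \<open>j \<le> n\<close>] show ?thesis
      proof cases
        case 2
        then have "l = i" using quasi_kernel_D_K_unique[OF qk] i by blast
        then show ?thesis using l d mod_add_neq_self[of d "2 * n + 1" i] by simp
      next
        case (3 e)
        then have "(l + e) mod (2 * n + 1) = i"
          using quasi_kernel_D_K_unique[OF qk] i by blast
        \<comment> \<open>An arc from \<open>K l\<close> back to \<open>K i\<close> would close a
          2-cycle, but \<open>d + e\<close> is between 2 and 2n.\<close>
        then have "(i + (d + e)) mod (2 * n + 1) = i"
          using l by (simp add: mod_add_left_eq add.assoc)
        then show ?thesis using d 3 mod_add_neq_self[of "d + e" "2 * n + 1" i] by simp
      qed
    qed
    have "n\<^sup>2 + 1 = card (insert (K i) (case_prod S ` (L \<times> {1..n})))"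
    proof (subst card_insert_disjoint)
      show "finite (case_prod S ` (L \<times> {1..n}))" by (simp add: L_def)
      show "K i \<notin> case_prod S ` (L \<times> {1..n})" by auto
    qed (simp only: card_S \<open>card L = n\<close> power2_eq_square Suc_eq_plus1)
    also have "\<dots> \<le> card Q"
      using i S_in by (intro card_mono fin) auto
    finally show ?thesis .
  next
    case False
    have "S l j \<in> Q" if "l \<le> 2 * n" "1 \<le> j" "j \<le> n" for l j
      using quasi_kernel_D_S_cases[OF qk that] False by blast
    then have "card (case_prod S ` ({..2 * n} \<times> {1..n})) \<le> card Q"
      by (intro card_mono fin) auto
    then have "(2 * n + 1) * n \<le> card Q" by (simp only: card_S card_atMost Suc_eq_plus1)
    \<comment> \<open>The positivity of \<open>n\<close> enters here: at 0 the right-hand side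
      vanishes.\<close>
    moreover have "n\<^sup>2 + 1 \<le> (2 * n + 1) * n"
      using n by (simp add: power2_eq_square)
    ultimately show ?thesis by linarith
  qed
qed

text \<open>The lower bound is attained by the quasi-kernel of \<open>quasi_kernel_D\<close>:
  \<open>K 0\<close> with the \<open>S\<close> vertices attached to its out-neighbours
  \<open>K 1\<close>, ..., \<open>K n\<close>.\<close>

lemma card_smallest_quasi_kernel_D:
  assumes "smallest_quasi_kernel (with_proj (D n)) Q" "1 \<le> n"
  shows "card Q = n\<^sup>2 + 1"
proof (rule antisym)
  let ?S = "case_prod S ` ({1..n} \<times> {1..n})"
  have "{K 0} \<union> {S i j |i j. 1 \<le> i \<and> i \<le> n \<and> 1 \<le> j \<and> j \<le> n} = insert (K 0) ?S"
    by force
  then have "quasi_kernel (with_proj (D n)) (insert (K 0) ?S)"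
    using quasi_kernel_D[of n] by simp
  then have "card Q \<le> card (insert (K 0) ?S)"
    using assms(1) by (auto simp: smallest_quasi_kernel_def is_arg_min_linorder)
  also have "card ?S = n\<^sup>2"
    by (subst card_image) (auto simp: inj_on_def power2_eq_square)
  then have "card (insert (K 0) ?S) = n\<^sup>2 + 1"
    by (subst card_insert_disjoint) auto
  finally show "card Q \<le> n\<^sup>2 + 1" .
  show "n\<^sup>2 + 1 \<le> card Q"
    using assms by (intro card_quasi_kernel_D_ge) (auto simp: smallest_quasi_kernel_def is_arg_min_def)
qed

theorem proposition2p1:
  fixes Q :: "nat \<Rightarrow> vertex set"
  assumes "\<And>n. n \<ge> 1 \<Longrightarrow> smallest_quasi_kernel (with_proj (D n)) (Q n)"
  shows "(\<lambda>n. real (card (Q n)) / real (card (pverts (D n)))) \<longlonglongrightarrow> 1 / 2"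
proof (rule Lim_transform_eventually)
  show "(\<lambda>n. (real n ^ 2 + 1) / ((2 * real n + 1) * (real n + 1))) \<longlonglongrightarrow> 1 / 2"
    by real_asymp
  show "\<forall>\<^sub>F n in sequentially. (real n ^ 2 + 1) / ((2 * real n + 1) * (real n + 1))
      = real (card (Q n)) / real (card (pverts (D n)))"
    \<comment> \<open>Nothing is assumed about \<open>Q 0\<close>, so the formula is claimed from
      index 1 on.\<close>
    using eventually_ge_at_top[of 1]
  proof eventually_elim
    case (elim n)
    then have "card (Q n) = n\<^sup>2 + 1"
      using assms card_smallest_quasi_kernel_D by blast
    then show ?case by (simp add: card_pverts_D algebra_simps)
  qed
qed

end
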